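(* Let $X$ be a nonempty set. Then $\mathsf{N}_{\mathrm{rd}}[X]=(\mathbb{N}_{\mathrm{rd}}[X],+,\times_{\mathrm{rd}},0,1)$, the set of polynomials over $X$ with the addition $+$ and the multiplication $\times_{\mathrm{rd}}$, is a right-distributive strong bimonoid.
   Context: A strong bimonoid is an algebra $(B,\oplus,\otimes,\mathbf 0,\mathbf 1)$ such that $(B,\oplus,\mathbf 0)$ is a commutative monoid, $(B,\otimes,\mathbf 1)$ is a monoid, and $b\otimes\mathbf 0=\mathbf 0\otimes b=\mathbf 0$ for all $b$. It is right-distributive if $(a\oplus b)\otimes c=(a\otimes c)\oplus(b\otimes c)$ for all $a,b,c$. Terms. $\mathrm{T}(X)$ is the set of all terms built from elements of $X$, constants $\hat 0,\hat 1$, and binary symbols $\hat+,\hat\times$ (infix). $\mathrm{size}(t)$ is the total number of occurrences of symbols (elements of $X$, constants, binary symbols) in $t$. Simple terms. $s\in \mathrm{T}(X)$ is simple if $s=\hat 0$, or $s$ contains neither $\hat 0$ nor any subterm of the form $\hat 1\hat\times s'$ or $s'\hat\times\hat 1$. $\mathrm{ST}(X)$ is the set of simple terms. For $s,t\in \mathrm{ST}(X)$, $s=_{\mathrm{AC}}t$ means that $t$ is obtained from $s$ by finitely many steps, each replacing a subterm occurrence using, in either direction, one of: $a\hat+(b\hat+c)\leftrightarrow(a\hat+b)\hat+c$, $a\hat+b\leftrightarrow b\hat+a$, $a\hat\times(b\hat\times c)\leftrightarrow(a\hat\times b)\hat\times c$. $[s]_{\mathrm{AC}}$ is the class of $s$;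 $\mathbb{N}_{\mathrm{sb}}[X]=\mathrm{ST}(X)/{=_{\mathrm{AC}}}$; $0=[\hat 0]_{\mathrm{AC}}$, $1=[\hat 1]_{\mathrm{AC}}$; $X/\mathrm{AC}=\{[x]_{\mathrm{AC}}\mid x\in X\}$; $\mathrm{size}([s]_{\mathrm{AC}})=\mathrm{size}(s)$ (well defined). Operations on $\mathbb{N}_{\mathrm{sb}}[X]$: $p+0=0+p=p$, and $[s]_{\mathrm{AC}}+[t]_{\mathrm{AC}}=[s\hat+t]_{\mathrm{AC}}$ for $s,t\neq\hat 0$; $p\times 0=0\times p=0$, $p\times1=1\times p=p$, and $[s]_{\mathrm{AC}}\times[t]_{\mathrm{AC}}=[s\hat\times t]_{\mathrm{AC}}$ for $s,t\notin\{\hat 0,\hat 1\}$. Polynomials. A monomial term is a term built from elements of $X$ using only $\hat\times$; a monomial is the class of a monomial term. The set $\mathrm{PT}(X)$ of polynomial terms is the smallest $U\subseteq \mathrm{ST}(X)$ with: (a) $\hat 0,\hat 1$ and all monomial terms are in $U$; (b) if $s,t\in U\setminus\{\hat 0\}$ then $s\hat+t\in U$; (c) if $s$ is a monomial term and $t\in U\setminus\{\hat 0,\hat 1\}$ then $s\hat\times t\in U$. Terms arising by (b) (resp. (c)) are sum (resp. product) polynomial terms. $\mathbb{N}_{\mathrm{rd}}[X]=\{[t]_{\mathrm{AC}}\mid t\in \mathrm{PT}(X)\}$, whose elements are called polynomials; classes of sum (product) polynomial terms are sum (product) polynomials. $\mathbb{N}_{\mathrm{rd}}[X]$ is closed under $+$.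 Facts making the next definition meaningful: every polynomial outside $X/\mathrm{AC}\cup\{0,1\}$ is exactly one of a sum polynomial or a product polynomial; each sum polynomial is $q_1+\dots+q_n$ with $n\ge2$ and each $q_i$ a product polynomial or in $X/\mathrm{AC}\cup\{1\}$, uniquely up to permutation; each product polynomial that is not a monomial is $m\times q'$ for a unique monomial $m$ and unique sum polynomial $q'$. Multiplication $\times_{\mathrm{rd}}$ on $\mathbb{N}_{\mathrm{rd}}[X]$, by induction on $\mathrm{size}(q)$: $q\times_{\mathrm{rd}}0=0\times_{\mathrm{rd}}q=0$, $q\times_{\mathrm{rd}}1=1\times_{\mathrm{rd}}q=q$; for $q,r\notin\{0,1\}$: if $q$ is a monomial, $q\times_{\mathrm{rd}}r=q\times r$; if $q$ is a sum polynomial, written as $q=q_1+\dots+q_n$ with $n\ge2$ and each $q_i$ a product polynomial or in $X/\mathrm{AC}\cup\{1\}$, $q\times_{\mathrm{rd}}r=q_1\times_{\mathrm{rd}}r+\dots+q_n\times_{\mathrm{rd}}r$; if $q=m\times q'$ with $m$ a monomial and $q'$ a sum polynomial, $q\times_{\mathrm{rd}}r=m\times(q'\times_{\mathrm{rd}}r)$. *)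

theory Defs
  imports "HOL-Algebra.Ring"
begin

section \<open>Strong bimonoids\<close>

locale strong_bimonoid = abelian_monoid R + monoid R for R (structure) +
  assumes l_null: "x \<in> carrier R \<Longrightarrow> \<zero> \<otimes> x = \<zero>"
    and r_null: "x \<in> carrier R \<Longrightarrow> x \<otimes> \<zero> = \<zero>"

text \<open>The law called right-distributivity here is the one HOL-Algebra calls \<open>l_distr\<close>.\<close>

locale right_distributive_strong_bimonoid = strong_bimonoid +
  assumes right_distr:
    "\<lbrakk>x \<in> carrier R; y \<in> carrier R; z \<in> carrier R\<rbrakk>
      \<Longrightarrow> (x \<oplus> y) \<otimes> z = (x \<otimes> z) \<oplus> (y \<otimes> z)"


section \<open>Terms and simple terms\<close>

datatype (vars: 'x) sbterm =
    Var 'x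
  | Zero
  | One
  | Add "'x sbterm" "'x sbterm"
  | Mul "'x sbterm" "'x sbterm"

definition terms :: "'x set \<Rightarrow> 'x sbterm set" where
  "terms X = {t. vars t \<subseteq> X}"

fun subterms :: "'x sbterm \<Rightarrow> 'x sbterm set" where
  "subterms (Var x) = {Var x}"
| "subterms Zero = {Zero}"
| "subterms One = {One}"
| "subterms (Add s t) = insert (Add s t) (subterms s \<union> subterms t)"
| "subterms (Mul s t) = insert (Mul s t) (subterms s \<union> subterms t)"

definition simple :: "'x sbterm \<Rightarrow> bool" where
  "simple s \<longleftrightarrow> s = Zero \<or>
     (Zero \<notin> subterms s \<and>
      (\<forall>s'. Mul One s' \<notin> subterms s \<and> Mul s' One \<notin> subterms s))"

definition simple_terms :: "'x set \<Rightarrow> 'x sbterm set" where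
  "simple_terms X = {s \<in> terms X. simple s}"


section \<open>Equality modulo AC\<close>

inductive ac_step :: "'x sbterm \<Rightarrow> 'x sbterm \<Rightarrow> bool" where
  add_assoc: "ac_step (Add a (Add b c)) (Add (Add a b) c)"
| add_comm: "ac_step (Add a b) (Add b a)"
| mul_assoc: "ac_step (Mul a (Mul b c)) (Mul (Mul a b) c)"
| add_left: "ac_step s s' \<Longrightarrow> ac_step (Add s t) (Add s' t)"
| add_right: "ac_step t t' \<Longrightarrow> ac_step (Add s t) (Add s t')"
| mul_left: "ac_step s s' \<Longrightarrow> ac_step (Mul s t) (Mul s' t)"
| mul_right: "ac_step t t' \<Longrightarrow> ac_step (Mul s t) (Mul s t')"

text \<open>\<open>equivclp\<close> allows each step to be used in either direction. A step never leaves the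
  simple terms over \<open>X\<close>, so the intermediate terms need no restriction.\<close>

definition ac_rel :: "'x set \<Rightarrow> ('x sbterm \<times> 'x sbterm) set" where
  "ac_rel X = {(s, t). s \<in> simple_terms X \<and> t \<in> simple_terms X \<and> equivclp ac_step s t}"

definition ac_class :: "'x set \<Rightarrow> 'x sbterm \<Rightarrow> 'x sbterm set" where
  "ac_class X s = ac_rel X `` {s}"

definition sb_zero :: "'x set \<Rightarrow> 'x sbterm set" where
  "sb_zero X = ac_class X Zero"

definition sb_one :: "'x set \<Rightarrow> 'x sbterm set" where
  "sb_one X = ac_class X One"

text \<open>As usual for operations on equivalence classes, the unions below run over all
  representatives; every member of the union is the same class.\<close>

definition sb_add :: "'x set \<Rightarrow> 'x sbterm set \<Rightarrow> 'x sbterm set \<Rightarrow> 'x sbterm set" where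
  "sb_add X p q =
     (if p = sb_zero X then q
      else if q = sb_zero X then p
      else (\<Union>s\<in>p. \<Union>t\<in>q. ac_class X (Add s t)))"

definition sb_times :: "'x set \<Rightarrow> 'x sbterm set \<Rightarrow> 'x sbterm set \<Rightarrow> 'x sbterm set" where
  "sb_times X p q =
     (if p = sb_zero X \<or> q = sb_zero X then sb_zero X
      else if p = sb_one X then q
      else if q = sb_one X then p
      else (\<Union>s\<in>p. \<Union>t\<in>q. ac_class X (Mul s t)))"

text \<open>\<open>q\<^sub>1 + \<dots> + q\<^sub>n\<close>; the trailing zero is neutral by definition of \<^const>\<open>sb_add\<close>.\<close>

definition sb_sum :: "'x set \<Rightarrow> 'x sbterm set list \<Rightarrow> 'x sbterm set" where
  "sb_sum X ps = foldr (sb_add X) ps (sb_zero X)"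


section \<open>Polynomials\<close>

inductive_set monomial_terms :: "'x set \<Rightarrow> 'x sbterm set" for X :: "'x set" where
  var: "x \<in> X \<Longrightarrow> Var x \<in> monomial_terms X"
| mul: "s \<in> monomial_terms X \<Longrightarrow> t \<in> monomial_terms X \<Longrightarrow> Mul s t \<in> monomial_terms X"

inductive_set poly_terms :: "'x set \<Rightarrow> 'x sbterm set" for X :: "'x set" where
  zero: "Zero \<in> poly_terms X"
| one: "One \<in> poly_terms X"
| monomial: "s \<in> monomial_terms X \<Longrightarrow> s \<in> poly_terms X"
| sum: "\<lbrakk>s \<in> poly_terms X; s \<noteq> Zero; t \<in> poly_terms X; t \<noteq> Zero\<rbrakk>
    \<Longrightarrow> Add s t \<in> poly_terms X"
| prod: "\<lbrakk>s \<in> monomial_terms X; t \<in> poly_terms X; t \<noteq> Zero; t \<noteq> One\<rbrakk>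
    \<Longrightarrow> Mul s t \<in> poly_terms X"

definition sum_poly_terms :: "'x set \<Rightarrow> 'x sbterm set" where
  "sum_poly_terms X =
     {Add s t | s t. s \<in> poly_terms X - {Zero} \<and> t \<in> poly_terms X - {Zero}}"

definition prod_poly_terms :: "'x set \<Rightarrow> 'x sbterm set" where
  "prod_poly_terms X =
     {Mul s t | s t. s \<in> monomial_terms X \<and> t \<in> poly_terms X - {Zero, One}}"

definition var_classes :: "'x set \<Rightarrow> 'x sbterm set set" where
  "var_classes X = (\<lambda>x. ac_class X (Var x)) ` X"

definition monomials :: "'x set \<Rightarrow> 'x sbterm set set" where
  "monomials X = ac_class X ` monomial_terms X"

definition polynomials :: "'x set \<Rightarrow> 'x sbterm set set" where
  "polynomials X = ac_class X ` poly_terms X"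

definition sum_polynomials :: "'x set \<Rightarrow> 'x sbterm set set" where
  "sum_polynomials X = ac_class X ` sum_poly_terms X"

definition prod_polynomials :: "'x set \<Rightarrow> 'x sbterm set set" where
  "prod_polynomials X = ac_class X ` prod_poly_terms X"


section \<open>Multiplication of polynomials\<close>

text \<open>\<open>rd_times_graph X q r p\<close> is the graph of the recursion defining \<open>q \<times>\<^sub>r\<^sub>d r = p\<close>. The recursive
  premises concern polynomials of smaller size than \<open>q\<close>. As a sum polynomial determines its
  summands only up to permutation, the clause \<open>sum\<close> admits every way of listing them;
  the product is the unique value \<open>p\<close>.\<close>

inductive rd_times_graph ::
  "'x set \<Rightarrow> 'x sbterm set \<Rightarrow> 'x sbterm set \<Rightarrow> 'x sbterm set \<Rightarrow> bool"
  for X :: "'x set" where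
  zero_right: "q \<in> polynomials X \<Longrightarrow> rd_times_graph X q (sb_zero X) (sb_zero X)"
| zero_left: "q \<in> polynomials X \<Longrightarrow> rd_times_graph X (sb_zero X) q (sb_zero X)"
| one_right: "q \<in> polynomials X \<Longrightarrow> rd_times_graph X q (sb_one X) q"
| one_left: "q \<in> polynomials X \<Longrightarrow> rd_times_graph X (sb_one X) q q"
| monomial: "\<lbrakk>q \<in> monomials X; r \<in> polynomials X - {sb_zero X, sb_one X}\<rbrakk>
    \<Longrightarrow> rd_times_graph X q r (sb_times X q r)"
| sum: "\<lbrakk>q \<in> sum_polynomials X; r \<in> polynomials X - {sb_zero X, sb_one X};
      q = sb_sum X qs; length qs \<ge> 2;
      set qs \<subseteq> prod_polynomials X \<union> var_classes X \<union> {sb_one X};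
      list_all2 (\<lambda>q\<^sub>i p\<^sub>i. rd_times_graph X q\<^sub>i r p\<^sub>i) qs ps\<rbrakk>
    \<Longrightarrow> rd_times_graph X q r (sb_sum X ps)"
| prod: "\<lbrakk>m \<in> monomials X; q' \<in> sum_polynomials X; q = sb_times X m q';
      r \<in> polynomials X - {sb_zero X, sb_one X}; rd_times_graph X q' r p\<rbrakk>
    \<Longrightarrow> rd_times_graph X q r (sb_times X m p)"

definition rd_times :: "'x set \<Rightarrow> 'x sbterm set \<Rightarrow> 'x sbterm set \<Rightarrow> 'x sbterm set" where
  "rd_times X q r = (THE p. rd_times_graph X q r p)"

definition N_rd :: "'x set \<Rightarrow> 'x sbterm set ring" where
  "N_rd X = \<lparr>carrier = polynomials X, monoid.mult = rd_times X, one = sb_one X,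
             zero = sb_zero X, add = sb_add X\<rparr>"

end

theory Submission
  imports Defs "HOL-Library.Multiset"
begin

text \<open>
  The idea is to identify polynomials with the elements of a concrete model of the free
  right-distributive strong bimonoid, in which the laws are plain to see. Right-distributivity
  lets one expand every product from the left, \<open>(a + b) \<times> c = a \<times> c + b \<times> c\<close>, but never from the
  right. Fully expanded, an expression is therefore a finite multiset of summands, and each summand
  is either \<open>1\<close> or \<open>x \<times> (\<dots>)\<close> for a variable \<open>x\<close> and another nonempty multiset of summands; a
  monomial \<open>x \<times> y\<close> has the form \<open>x \<times> (y \<times> 1)\<close>. Addition is multiset union, multiplication
  replaces each final \<open>1\<close> of the left factor by the right factor, and \<open>0\<close> is the empty
  multiset. Associativity of this multiplication is a structural induction
  (\<open>nf_times_assoc\<close>), and distributivity over a union on the left is built in.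

  Every term is evaluated in this model by \<open>nf\<close>. As the AC laws hold in the model,
  AC-equal terms have the same value. For polynomial terms the converse is true as well
  (\<open>poly_ac_equiv_iff\<close>): a value can be read back as a term, and a polynomial term is already
  expanded, so it is AC-equal to the term read back from its own value. Hence \<open>class_nf\<close>, the value
  of a class, is injective on polynomials.

  It remains to see that \<open>class_nf\<close> turns the operations on polynomials into those of the model.
  For \<open>\<times>\<^sub>r\<^sub>d\<close>, every clause of the recursion is an identity of the model, so whatever the recursion
  relates to \<open>q\<close> and \<open>r\<close> has the value \<open>class_nf q\<close> times \<open>class_nf r\<close>
  (\<open>rd_times_graph_sound\<close>). By injectivity the product is thus unique, and it exists because each
  polynomial decomposes as the clauses require (\<open>rd_times_graph_exists\<close>). Each law
  now follows by comparing the values of its two sides.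
\<close>

section \<open>The free right-distributive strong bimonoid\<close>

text \<open>
  \<open>Prefix x M\<close> stands for \<open>x \<times> \<Sum>M\<close>. The type also contains summands with an empty tail, which
  would denote \<open>x \<times> 0 = 0\<close>; values of terms never contain them, because \<open>prefix_sum\<close> below maps
  an empty tail to the empty sum.
\<close>

datatype 'x summand = Unit | Prefix 'x "'x summand multiset"

definition prefix_sum :: "'x \<Rightarrow> 'x summand multiset \<Rightarrow> 'x summand multiset" where
  "prefix_sum x M = (if M = {#} then {#} else {#Prefix x M#})"

primrec summand_times :: "'x summand \<Rightarrow> 'x summand multiset \<Rightarrow> 'x summand multiset" where
  "summand_times Unit N = N"
| "summand_times (Prefix x M) N = prefix_sum x (\<Sum>\<^sub># (image_mset (\<lambda>m. summand_times m N) M))"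

definition nf_times :: "'x summand multiset \<Rightarrow> 'x summand multiset \<Rightarrow> 'x summand multiset" where
  "nf_times M N = (\<Sum>m\<in>#M. summand_times m N)"

lemma nf_times_simps [simp]:
  "nf_times {#} N = {#}"
  "nf_times {#Unit#} N = N"
  "nf_times {#Prefix x M#} N = prefix_sum x (nf_times M N)"
  "nf_times (M + M') N = nf_times M N + nf_times M' N"
  by (simp_all add: nf_times_def)

lemma nf_times_prefix_sum: "nf_times (prefix_sum x M) N = prefix_sum x (nf_times M N)"
  by (simp add: nf_times_def prefix_sum_def)

lemma nf_times_assoc: "nf_times (nf_times M N) K = nf_times M (nf_times N K)"
proof -
  have sum: "nf_times (\<Sum>m\<in>#M. f m) K = (\<Sum>m\<in>#M. nf_times (f m) K)"
    for f :: "'a summand \<Rightarrow> 'a summand multiset" and M :: "'a summand multiset"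
    by (induction M) simp_all
  have "nf_times (summand_times m N) K = summand_times m (nf_times N K)" for m
  proof (induction m)
    case (Prefix x M)
    then have "(\<Sum>m\<in>#M. nf_times (summand_times m N) K) =
        (\<Sum>m\<in>#M. summand_times m (nf_times N K))"
      by (metis (mono_tags, lifting) image_mset_cong)
    then show ?case by (simp add: nf_times_prefix_sum sum)
  qed simp
  then show ?thesis by (simp add: nf_times_def[of M] sum)
qed

lemma nf_times_empty_right [simp]: "nf_times M {#} = {#}"
proof -
  have "summand_times m {#} = {#}" for m :: "'a summand"
    by (induction m) (auto simp: prefix_sum_def)
  then show ?thesis by (simp add: nf_times_def)
qed

section \<open>Normal forms of terms\<close>

primrec nf :: "'x sbterm \<Rightarrow> 'x summand multiset" where
  "nf (Var x) = {#Prefix x {#Unit#}#}"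
| "nf Zero = {#}"
| "nf One = {#Unit#}"
| "nf (Add s t) = nf s + nf t"
| "nf (Mul s t) = nf_times (nf s) (nf t)"

text \<open>
  Right neutrality fails for a summand with an empty tail, which \<open>prefix_sum\<close> erases. Values of
  terms are free of such summands, and an induction on the term takes advantage of this.
\<close>

lemma nf_times_unit_right [simp]: "nf_times (nf s) {#Unit#} = nf s"
  by (induction s) (auto simp: nf_times_assoc prefix_sum_def)

abbreviation ac_equiv :: "'x sbterm \<Rightarrow> 'x sbterm \<Rightarrow> bool" (infix "\<approx>" 50) where
  "s \<approx> t \<equiv> equivclp ac_step s t"

lemma nf_ac_equiv: "s \<approx> t \<Longrightarrow> nf s = nf t"
proof (induction rule: equivclp_induct)
  case (step t u)
  have "nf t = nf u" if "ac_step t u" for t u :: "'a sbterm"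
    using that by induction (auto simp: nf_times_assoc)
  then show ?case using step by metis
qed simp

lemma equivclp_cong:
  assumes "\<And>s t. R s t \<Longrightarrow> R (f s) (f t)" and "equivclp R s t"
  shows "equivclp R (f s) (f t)"
  using assms(2)
proof (induction rule: equivclp_induct)
  case (step t u)
  then have "equivclp R (f t) (f u)"
    by (metis assms(1) r_into_equivclp equivclp_sym)
  with step show ?case by (metis equivclp_trans)
qed simp

lemma ac_equiv_Add: "s \<approx> s' \<Longrightarrow> t \<approx> t' \<Longrightarrow> Add s t \<approx> Add s' t'"
  using equivclp_cong[of ac_step "\<lambda>s. Add s t" s s'] equivclp_cong[of ac_step "Add s'" t t']
    ac_step.add_left ac_step.add_right
  by (metis equivclp_trans)

lemma ac_equiv_Mul: "s \<approx> s' \<Longrightarrow> t \<approx> t' \<Longrightarrow> Mul s t \<approx> Mul s' t'"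
  using equivclp_cong[of ac_step "\<lambda>s. Mul s t" s s'] equivclp_cong[of ac_step "Mul s'" t t']
    ac_step.mul_left ac_step.mul_right
  by (metis equivclp_trans)

lemma Add_assoc: "Add (Add a b) c \<approx> Add a (Add b c)"
  by (metis ac_step.add_assoc r_into_equivclp equivclp_sym)

lemma Add_comm: "Add a b \<approx> Add b a"
  by (metis ac_step.add_comm r_into_equivclp)

lemma Mul_assoc: "Mul (Mul a b) c \<approx> Mul a (Mul b c)"
  by (metis ac_step.mul_assoc r_into_equivclp equivclp_sym)

section \<open>Reading a normal form back as a term\<close>

fun list_sum :: "'x sbterm list \<Rightarrow> 'x sbterm" where
  "list_sum [] = Zero"
| "list_sum [t] = t"
| "list_sum (t # u # ts) = Add t (list_sum (u # ts))"

lemma list_sum_Cons: "ts \<noteq> [] \<Longrightarrow> list_sum (t # ts) = Add t (list_sum ts)"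
  by (cases ts) auto

lemma list_sum_append:
  "ts \<noteq> [] \<Longrightarrow> us \<noteq> [] \<Longrightarrow> list_sum (ts @ us) \<approx> Add (list_sum ts) (list_sum us)"
proof (induction ts rule: list_sum.induct)
  case (2 t)
  then show ?case by (simp add: list_sum_Cons)
next
  case (3 t u ts)
  then have "Add t (list_sum ((u # ts) @ us)) \<approx> Add t (Add (list_sum (u # ts)) (list_sum us))"
    by (intro ac_equiv_Add) simp_all
  then show ?case by simp (metis Add_assoc equivclp_sym equivclp_trans)
qed simp

text \<open>
  A normal form does not order its summands, so reading it back involves a choice of an order.
  Associativity and commutativity make the choice immaterial.
\<close>

lemma list_sum_perm: "mset ts = mset us \<Longrightarrow> list_sum ts \<approx> list_sum us"
proof (induction ts arbitrary: us)
  case (Cons t ts)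
  then have "t \<in> set us" by (metis list.set_intros(1) mset_eq_setD)
  then obtain vs ws where us: "us = vs @ t # ws" by (meson split_list)
  have IH: "list_sum ts \<approx> list_sum (vs @ ws)"
    using Cons us by simp
  have front: "list_sum us \<approx> list_sum (t # vs @ ws)"
  proof (cases "vs = []")
    case False
    have "list_sum us \<approx> Add (list_sum vs) (list_sum (t # ws))"
      using us False list_sum_append by blast
    also have "\<dots> \<approx> list_sum (t # vs @ ws)"
    proof (cases "ws = []")
      case True
      then show ?thesis using False by (simp add: list_sum_Cons Add_comm)
    next
      case ne: False
      have "Add (list_sum vs) (list_sum (t # ws)) \<approx> Add (Add t (list_sum ws)) (list_sum vs)"
        using ne by (simp add: list_sum_Cons Add_comm)
      also have "\<dots> \<approx> Add t (Add (list_sum ws) (list_sum vs))"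
        by (rule Add_assoc)
      also have "\<dots> \<approx> Add t (list_sum (vs @ ws))"
        using False ne
        by (intro ac_equiv_Add equivclp_refl)
           (metis Add_comm equivclp_sym equivclp_trans list_sum_append)
      finally show ?thesis using ne by (simp add: list_sum_Cons)
    qed
    finally show ?thesis .
  qed (simp add: us)
  have "list_sum (t # ts) \<approx> list_sum (t # vs @ ws)"
  proof (cases "ts = []")
    case True
    then show ?thesis using Cons.prems us by simp
  next
    case False
    then have "vs @ ws \<noteq> []" using Cons.prems us by auto
    then show ?thesis using False IH by (simp add: list_sum_Cons ac_equiv_Add)
  qed
  with front show ?case by (metis equivclp_sym equivclp_trans)
qed simp

definition mset_sum :: "'x sbterm multiset \<Rightarrow> 'x sbterm" where
  "mset_sum T = list_sum (SOME ts. mset ts = T)"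

lemma mset_sum_mset: "mset_sum (mset ts) \<approx> list_sum ts"
  unfolding mset_sum_def by (rule list_sum_perm) (rule someI, rule refl)

lemma mset_sum_single [simp]: "mset_sum {#t#} = t"
  by (simp add: mset_sum_def)

lemma mset_sum_add:
  assumes "T \<noteq> {#}" "U \<noteq> {#}"
  shows "mset_sum (T + U) \<approx> Add (mset_sum T) (mset_sum U)"
proof -
  obtain ts us where "T = mset ts" "U = mset us" by (metis ex_mset)
  have "mset_sum (T + U) \<approx> list_sum (ts @ us)"
    using mset_sum_mset[of "ts @ us"] by (simp add: \<open>T = _\<close> \<open>U = _\<close>)
  also have "\<dots> \<approx> Add (list_sum ts) (list_sum us)"
    using assms \<open>T = _\<close> \<open>U = _\<close> by (intro list_sum_append) auto
  also have "\<dots> \<approx> Add (mset_sum T) (mset_sum U)"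
    unfolding \<open>T = _\<close> \<open>U = _\<close>
    by (intro ac_equiv_Add equivclp_sym[OF mset_sum_mset])
  finally show ?thesis .
qed

text \<open>Simple terms have no factor \<open>1\<close>, hence the variable alone when the tail is \<open>1\<close>.\<close>

primrec summand_term :: "'x summand \<Rightarrow> 'x sbterm" where
  "summand_term Unit = One"
| "summand_term (Prefix x M) =
     (if M = {#Unit#} then Var x else Mul (Var x) (mset_sum (image_mset summand_term M)))"

definition nf_term :: "'x summand multiset \<Rightarrow> 'x sbterm" where
  "nf_term M = mset_sum (image_mset summand_term M)"

lemma nf_term_single [simp]: "nf_term {#m#} = summand_term m"
  by (simp add: nf_term_def)

lemma nf_term_add:
  "M \<noteq> {#} \<Longrightarrow> N \<noteq> {#} \<Longrightarrow> nf_term (M + N) \<approx> Add (nf_term M) (nf_term N)"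
  by (simp add: nf_term_def mset_sum_add)

lemma summand_term_Prefix:
  "summand_term (Prefix x M) = (if M = {#Unit#} then Var x else Mul (Var x) (nf_term M))"
  by (simp add: nf_term_def)

section \<open>Normal forms classify polynomial terms\<close>

text \<open>
  A monomial does not branch before its end, so multiplying it by anything nonzero leaves a single
  summand that starts with a variable. This keeps products of polynomial terms apart from \<open>0\<close>, from
  \<open>1\<close> and from sums.
\<close>

lemma nf_times_monomial:
  assumes "s \<in> monomial_terms X" "N \<noteq> {#}"
  shows "\<exists>x M. nf_times (nf s) N = {#Prefix x M#}"
  using assms
proof (induction arbitrary: N)
  case (mul s t)
  then obtain x M where "nf_times (nf t) N = {#Prefix x M#}" by blast
  then show ?case using mul.IH(1)[of "nf_times (nf t) N"] by (simp add: nf_times_assoc)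
qed (simp add: prefix_sum_def)

lemma nf_monomial:
  assumes "s \<in> monomial_terms X"
  shows "\<exists>x M. nf s = {#Prefix x M#}"
  using nf_times_monomial[OF assms, of "{#Unit#}"] by simp

lemma monomial_not_const [simp]: "Zero \<notin> monomial_terms X" "One \<notin> monomial_terms X"
  using nf_monomial[of Zero X] nf_monomial[of One X] by auto

lemma nf_poly_term:
  assumes "s \<in> poly_terms X"
  shows "nf s = {#} \<longleftrightarrow> s = Zero" "nf s = {#Unit#} \<longleftrightarrow> s = One"
  using assms
proof induction
  case (monomial s)
  obtain x M where "nf s = {#Prefix x M#}" using nf_monomial[OF monomial] by blast
  then show "nf s = {#} \<longleftrightarrow> s = Zero" "nf s = {#Unit#} \<longleftrightarrow> s = One"
    by auto
next
  case (sum s t)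
  then show "nf (Add s t) = {#} \<longleftrightarrow> Add s t = Zero" "nf (Add s t) = {#Unit#} \<longleftrightarrow> Add s t = One"
    by (auto simp: union_is_single)
next
  case (prod s t)
  then have "nf t \<noteq> {#}" by simp
  then obtain x M where "nf_times (nf s) (nf t) = {#Prefix x M#}"
    using nf_times_monomial prod by metis
  then show "nf (Mul s t) = {#} \<longleftrightarrow> Mul s t = Zero" "nf (Mul s t) = {#Unit#} \<longleftrightarrow> Mul s t = One"
    by auto
qed auto

text \<open>
  Here associativity is used to move the factors of \<open>s\<close> one variable at a time in front of the
  rest. For the two excluded values the right factor would be \<open>0\<close> or \<open>1\<close>, which AC steps cannot
  absorb.
\<close>

lemma Mul_monomial_nf_term:
  assumes "s \<in> monomial_terms X" "N \<noteq> {#}" "N \<noteq> {#Unit#}"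
  shows "Mul s (nf_term N) \<approx> nf_term (nf_times (nf s) N)"
  using assms
proof (induction arbitrary: N)
  case (var x)
  then show ?case by (simp add: prefix_sum_def summand_term_Prefix del: summand_term.simps)
next
  case (mul s t)
  obtain x M where M: "nf_times (nf t) N = {#Prefix x M#}"
    using nf_times_monomial mul by metis
  have "Mul (Mul s t) (nf_term N) \<approx> Mul s (Mul t (nf_term N))"
    by (rule Mul_assoc)
  also have "\<dots> \<approx> Mul s (nf_term (nf_times (nf t) N))"
    using mul by (intro ac_equiv_Mul equivclp_refl) simp
  also have "\<dots> \<approx> nf_term (nf_times (nf s) (nf_times (nf t) N))"
    by (rule mul.IH(1)) (simp_all add: M)
  finally show ?case by (simp add: nf_times_assoc)
qed

lemma monomial_ac_equiv_nf_term:
  assumes "s \<in> monomial_terms X"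
  shows "s \<approx> nf_term (nf s)"
  using assms
proof induction
  case (mul s t)
  obtain x M where M: "nf t = {#Prefix x M#}"
    using nf_monomial mul by metis
  have "Mul s t \<approx> Mul s (nf_term (nf t))"
    using mul by (intro ac_equiv_Mul equivclp_refl)
  also have "\<dots> \<approx> nf_term (nf (Mul s t))"
    using Mul_monomial_nf_term[OF mul.hyps(1), of "nf t"] by (simp add: M del: summand_term.simps)
  finally show ?case .
qed simp

text \<open>
  A product inside a polynomial term has a monomial on its left. Evaluating it therefore never
  distributes over a sum, which is the one thing that AC steps cannot undo.
\<close>

lemma poly_ac_equiv_nf_term:
  assumes "s \<in> poly_terms X"
  shows "s \<approx> nf_term (nf s)"
  using assms
proof induction
  case zero
  then show ?case by (simp add: nf_term_def mset_sum_def)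
next
  case one
  then show ?case by simp
next
  case (monomial s)
  then show ?case by (rule monomial_ac_equiv_nf_term)
next
  case (sum s t)
  then have "Add s t \<approx> Add (nf_term (nf s)) (nf_term (nf t))" by (intro ac_equiv_Add)
  also have "\<dots> \<approx> nf_term (nf (Add s t))"
    using sum nf_poly_term(1) by (auto intro!: equivclp_sym[OF nf_term_add])
  finally show ?case .
next
  case (prod s t)
  then have "Mul s t \<approx> Mul s (nf_term (nf t))" by (intro ac_equiv_Mul equivclp_refl)
  also have "\<dots> \<approx> nf_term (nf (Mul s t))"
    using prod nf_poly_term Mul_monomial_nf_term by (metis nf.simps(5))
  finally show ?case .
qed

lemma poly_ac_equiv_iff:
  "s \<in> poly_terms X \<Longrightarrow> t \<in> poly_terms X \<Longrightarrow> s \<approx> t \<longleftrightarrow> nf s = nf t"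
  by (metis poly_ac_equiv_nf_term nf_ac_equiv equivclp_sym equivclp_trans)

section \<open>Classes of polynomial terms and their operations\<close>

lemma simple_terms_Add:
  "\<lbrakk>s \<in> simple_terms X; t \<in> simple_terms X; s \<noteq> Zero; t \<noteq> Zero\<rbrakk> \<Longrightarrow> Add s t \<in> simple_terms X"
  by (auto simp: simple_terms_def terms_def simple_def)

lemma simple_terms_Mul:
  "\<lbrakk>s \<in> simple_terms X; t \<in> simple_terms X; s \<noteq> Zero; t \<noteq> Zero; s \<noteq> One; t \<noteq> One\<rbrakk>
    \<Longrightarrow> Mul s t \<in> simple_terms X"
  by (auto simp: simple_terms_def terms_def simple_def)

lemma monomial_simple: "s \<in> monomial_terms X \<Longrightarrow> s \<in> simple_terms X"
proof (induction rule: monomial_terms.induct)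
  case (var x)
  then show ?case by (simp add: simple_terms_def terms_def simple_def)
next
  case (mul s t)
  then show ?case by (metis simple_terms_Mul monomial_not_const)
qed

lemma poly_simple: "s \<in> poly_terms X \<Longrightarrow> s \<in> simple_terms X"
proof (induction rule: poly_terms.induct)
  case (prod s t)
  then show ?case by (metis simple_terms_Mul monomial_simple monomial_not_const)
qed (simp_all add: monomial_simple simple_terms_Add,
    simp_all add: simple_terms_def terms_def simple_def)

lemma ac_class_simple:
  "s \<in> simple_terms X \<Longrightarrow> ac_class X s = {t \<in> simple_terms X. s \<approx> t}"
  by (auto simp: ac_class_def ac_rel_def)

text \<open>
  All members of a class have the same value, so the choice of a representative does not matter.
\<close>

definition class_nf :: "'x sbterm set \<Rightarrow> 'x summand multiset" where
  "class_nf p = nf (SOME s. s \<in> p)"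

lemma class_nf_simple:
  assumes "s \<in> simple_terms X"
  shows "class_nf (ac_class X s) = nf s"
proof -
  have "(SOME t. t \<in> ac_class X s) \<in> ac_class X s"
    by (rule someI[of _ s]) (simp add: ac_class_simple assms)
  then have "s \<approx> (SOME t. t \<in> ac_class X s)"
    using ac_class_simple[OF assms] by blast
  then show ?thesis
    unfolding class_nf_def by (rule nf_ac_equiv[symmetric])
qed

lemma class_nf_poly [simp]: "s \<in> poly_terms X \<Longrightarrow> class_nf (ac_class X s) = nf s"
  by (simp add: class_nf_simple poly_simple)

lemma ac_class_eqI:
  "\<lbrakk>s \<in> simple_terms X; t \<in> simple_terms X; s \<approx> t\<rbrakk> \<Longrightarrow> ac_class X s = ac_class X t"
  by (auto simp: ac_class_simple intro: equivclp_trans equivclp_sym)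

lemma class_nf_inj:
  assumes "p \<in> polynomials X" "q \<in> polynomials X" "class_nf p = class_nf q"
  shows "p = q"
proof -
  obtain s t where "s \<in> poly_terms X" "p = ac_class X s" "t \<in> poly_terms X" "q = ac_class X t"
    using assms by (auto simp: polynomials_def)
  then show ?thesis
    using assms(3) poly_ac_equiv_iff[of s X t] ac_class_eqI[of s X t] by (simp add: poly_simple)
qed

lemma class_nf_zero [simp]: "class_nf (sb_zero X) = {#}"
  and zero_poly [simp]: "sb_zero X \<in> polynomials X"
  and class_nf_one [simp]: "class_nf (sb_one X) = {#Unit#}"
  and one_poly [simp]: "sb_one X \<in> polynomials X"
  by (auto simp: sb_zero_def sb_one_def polynomials_def poly_terms.zero poly_terms.one)

text \<open>
  A representative of the class of a polynomial term is known to be simple only. Closure is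
  required for all representatives, since \<open>ac_class\<close> is empty on terms that are not simple.
\<close>

lemma UN_ac_class:
  assumes s: "s \<in> simple_terms X" and t: "t \<in> simple_terms X"
    and cong: "\<And>s' t'. s \<approx> s' \<Longrightarrow> t \<approx> t' \<Longrightarrow> f s t \<approx> f s' t'"
    and closed: "\<And>s' t'. \<lbrakk>s' \<in> simple_terms X; t' \<in> simple_terms X; s \<approx> s'; t \<approx> t'\<rbrakk>
      \<Longrightarrow> f s' t' \<in> simple_terms X"
  shows "(\<Union>s'\<in>ac_class X s. \<Union>t'\<in>ac_class X t. ac_class X (f s' t')) = ac_class X (f s t)"
proof -
  have "ac_class X (f s' t') = ac_class X (f s t)"
    if "s' \<in> ac_class X s" "t' \<in> ac_class X t" for s' t'
    using that s t cong closed
    by (intro ac_class_eqI) (auto simp: ac_class_simple intro: equivclp_sym)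
  moreover have "s \<in> ac_class X s" "t \<in> ac_class X t"
    using s t by (auto simp: ac_class_simple)
  ultimately show ?thesis by blast
qed

lemma sb_add_ac_class:
  assumes "s \<in> poly_terms X" "t \<in> poly_terms X" "s \<noteq> Zero" "t \<noteq> Zero"
  shows "sb_add X (ac_class X s) (ac_class X t) = ac_class X (Add s t)"
proof -
  have "ac_class X s \<noteq> sb_zero X" "ac_class X t \<noteq> sb_zero X"
    using assms nf_poly_term by (metis class_nf_poly class_nf_zero)+
  moreover have "nf s \<noteq> {#}" "nf t \<noteq> {#}"
    using assms nf_poly_term by metis+
  then have "(\<Union>s'\<in>ac_class X s. \<Union>t'\<in>ac_class X t. ac_class X (Add s' t')) = ac_class X (Add s t)"
    using assms
    by (intro UN_ac_class ac_equiv_Add simple_terms_Add) (auto dest: nf_ac_equiv simp: poly_simple)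
  ultimately show ?thesis
    by (simp add: sb_add_def)
qed

lemma sb_times_ac_class:
  assumes "s \<in> poly_terms X" "t \<in> poly_terms X"
    and "s \<noteq> Zero" "t \<noteq> Zero" "s \<noteq> One" "t \<noteq> One"
  shows "sb_times X (ac_class X s) (ac_class X t) = ac_class X (Mul s t)"
proof -
  have "ac_class X s \<noteq> sb_zero X" "ac_class X t \<noteq> sb_zero X"
    "ac_class X s \<noteq> sb_one X" "ac_class X t \<noteq> sb_one X"
    using assms nf_poly_term by (metis class_nf_poly class_nf_zero class_nf_one)+
  moreover have "nf s \<noteq> {#}" "nf t \<noteq> {#}" "nf s \<noteq> {#Unit#}" "nf t \<noteq> {#Unit#}"
    using assms nf_poly_term by metis+
  then have "(\<Union>s'\<in>ac_class X s. \<Union>t'\<in>ac_class X t. ac_class X (Mul s' t')) = ac_class X (Mul s t)"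
    using assms
    by (intro UN_ac_class ac_equiv_Mul simple_terms_Mul) (auto dest: nf_ac_equiv simp: poly_simple)
  ultimately show ?thesis
    by (simp add: sb_times_def)
qed

lemma
  assumes "p \<in> polynomials X" "q \<in> polynomials X"
  shows sb_add_poly: "sb_add X p q \<in> polynomials X"
    and class_nf_add: "class_nf (sb_add X p q) = class_nf p + class_nf q"
proof -
  obtain s t where st: "s \<in> poly_terms X" "p = ac_class X s" "t \<in> poly_terms X" "q = ac_class X t"
    using assms by (auto simp: polynomials_def)
  have "sb_add X p q \<in> polynomials X \<and> class_nf (sb_add X p q) = class_nf p + class_nf q"
  proof (cases "s = Zero \<or> t = Zero")
    case True
    then have "p = sb_zero X \<or> q = sb_zero X" using st by (auto simp: sb_zero_def)
    then show ?thesis using assms by (auto simp: sb_add_def)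
  next
    case False
    then have "Add s t \<in> poly_terms X" using st by (auto intro: poly_terms.sum)
    then show ?thesis using st False by (auto simp: sb_add_ac_class polynomials_def)
  qed
  then show "sb_add X p q \<in> polynomials X" "class_nf (sb_add X p q) = class_nf p + class_nf q"
    by auto
qed

lemma
  assumes "m \<in> monomials X" "q \<in> polynomials X"
  shows sb_times_poly: "sb_times X m q \<in> polynomials X"
    and class_nf_times: "class_nf (sb_times X m q) = nf_times (class_nf m) (class_nf q)"
proof -
  obtain s t where s: "s \<in> monomial_terms X" "m = ac_class X s"
    and t: "t \<in> poly_terms X" "q = ac_class X t"
    using assms by (auto simp: polynomials_def monomials_def)
  have sp: "s \<in> poly_terms X" "s \<noteq> Zero" "s \<noteq> One"
    using s(1) by (auto intro: poly_terms.monomial)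
  have "sb_times X m q \<in> polynomials X \<and>
      class_nf (sb_times X m q) = nf_times (class_nf m) (class_nf q)"
  proof (cases "t = Zero \<or> t = One")
    case True
    then have "q = sb_zero X \<or> q = sb_one X" using t by (auto simp: sb_zero_def sb_one_def)
    moreover have "class_nf m = nf s" "m \<in> polynomials X"
      using s sp by (auto simp: polynomials_def)
    ultimately show ?thesis using assms by (auto simp: sb_times_def)
  next
    case False
    then have "Mul s t \<in> poly_terms X" using s t by (auto intro: poly_terms.prod)
    then show ?thesis using s sp t False by (auto simp: sb_times_ac_class polynomials_def)
  qed
  then show "sb_times X m q \<in> polynomials X"
    "class_nf (sb_times X m q) = nf_times (class_nf m) (class_nf q)"
    by auto
qed

lemma
  assumes "set ps \<subseteq> polynomials X"
  shows sb_sum_poly: "sb_sum X ps \<in> polynomials X"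
    and class_nf_sum: "class_nf (sb_sum X ps) = (\<Sum>p\<leftarrow>ps. class_nf p)"
  using assms by (induction ps) (auto simp: sb_sum_def sb_add_poly class_nf_add)

lemma monomials_poly: "monomials X \<subseteq> polynomials X"
  by (auto simp: monomials_def polynomials_def poly_terms.monomial)

lemma sum_polynomials_poly: "sum_polynomials X \<subseteq> polynomials X"
  by (auto simp: sum_polynomials_def polynomials_def sum_poly_terms_def poly_terms.sum)

section \<open>The multiplication of polynomials\<close>

text \<open>
  The clauses for sums and for products are distributivity and associativity in the model. The
  values of \<open>q\<close> and \<open>r\<close> alone determine the value of \<open>p\<close>, whichever decomposition of \<open>q\<close> was used,
  so the product is unique.
\<close>

lemma rd_times_graph_sound:
  assumes "rd_times_graph X q r p"
  shows "q \<in> polynomials X \<and> r \<in> polynomials X \<and> p \<in> polynomials X \<and>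
    class_nf p = nf_times (class_nf q) (class_nf r)"
  using assms
proof (induction rule: rd_times_graph.induct)
  case (one_right q)
  then obtain s where "s \<in> poly_terms X" "q = ac_class X s" by (auto simp: polynomials_def)
  then show ?case using one_right by simp
next
  case (monomial q r)
  then show ?case using monomials_poly by (auto simp: sb_times_poly class_nf_times)
next
  case (sum q r qs ps)
  have "set qs \<subseteq> polynomials X \<and> set ps \<subseteq> polynomials X \<and>
      (\<Sum>p\<leftarrow>ps. class_nf p) = nf_times (\<Sum>q\<leftarrow>qs. class_nf q) (class_nf r)"
    using sum.IH by (induction rule: list_all2_induct) auto
  then show ?case
    using sum sum_polynomials_poly by (auto simp: sb_sum_poly class_nf_sum)
next
  case (prod m q' q r p)
  then show ?case by (auto simp: sb_times_poly class_nf_times nf_times_assoc)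
qed simp_all

lemma rd_times_graph_unique:
  "rd_times_graph X q r p \<Longrightarrow> rd_times_graph X q r p' \<Longrightarrow> p = p'"
  by (metis rd_times_graph_sound class_nf_inj)

lemma sb_sum_append:
  assumes "set ps \<subseteq> polynomials X" "set qs \<subseteq> polynomials X"
  shows "sb_sum X (ps @ qs) = sb_add X (sb_sum X ps) (sb_sum X qs)"
  using assms
  by (intro class_nf_inj[of _ X]) (auto simp: sb_sum_poly sb_add_poly class_nf_sum class_nf_add)

lemma sb_sum_single: "p \<in> polynomials X \<Longrightarrow> sb_sum X [p] = p"
  by (simp add: sb_sum_def sb_add_def)

text \<open>The summands \<open>q\<^sub>i\<close> allowed in the recursion for a sum polynomial.\<close>

definition atomic_polynomials :: "'x set \<Rightarrow> 'x sbterm set set" where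
  "atomic_polynomials X = prod_polynomials X \<union> var_classes X \<union> {sb_one X}"

lemma atomic_polynomials_poly: "atomic_polynomials X \<subseteq> polynomials X"
  by (auto simp: atomic_polynomials_def prod_polynomials_def prod_poly_terms_def var_classes_def
      polynomials_def poly_terms.prod poly_terms.monomial monomial_terms.var sb_one_def
      intro!: imageI poly_terms.one)

lemma monomial_atomic:
  assumes "s \<in> monomial_terms X"
  shows "ac_class X s \<in> atomic_polynomials X"
  using assms
proof cases
  case (mul s t)
  then have "Mul s t \<in> prod_poly_terms X"
    by (auto simp: prod_poly_terms_def poly_terms.monomial)
  then show ?thesis using mul by (simp add: atomic_polynomials_def prod_polynomials_def)
qed (simp add: atomic_polynomials_def var_classes_def)

text \<open>
  Two strengthenings make an induction over polynomial terms work. A sum term may have sums as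
  arguments, whereas the recursion wants the list of all its non-sum summands at once; the first
  part collects this list, which has length one for a term that is not a sum. A product term may
  nest products, \<open>s \<times> (s' \<times> (\<dots>))\<close>, whereas the recursion wants the whole monomial in front of
  a sum; the second part allows for an arbitrary monomial \<open>m\<close> in front of \<open>s\<close>, which accumulates the
  factors that have been passed.
\<close>

lemma rd_times_graph_total:
  assumes r: "r \<in> polynomials X - {sb_zero X, sb_one X}"
    and "s \<in> poly_terms X" "s \<noteq> Zero"
  shows "\<exists>qs ps. qs \<noteq> [] \<and> ac_class X s = sb_sum X qs \<and> set qs \<subseteq> atomic_polynomials X \<and>
      list_all2 (\<lambda>q p. rd_times_graph X q r p) qs ps"
      (is "?summands s")
    and "s \<noteq> One \<Longrightarrow> m \<in> monomial_terms X \<Longrightarrow> \<exists>p. rd_times_graph X (ac_class X (Mul m s)) r p"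
      (is "_ \<Longrightarrow> _ \<Longrightarrow> ?product m s")
proof -
  have single: "?summands t" if "ac_class X t \<in> atomic_polynomials X"
    "rd_times_graph X (ac_class X t) r p" for t p
    using that atomic_polynomials_poly[of X]
    by (intro exI[of _ "[ac_class X t]"] exI[of _ "[p]"]) (simp add: sb_sum_single subset_iff)
  have mono: "\<exists>p. rd_times_graph X (ac_class X t) r p" if "t \<in> monomial_terms X" for t
    using rd_times_graph.monomial[OF _ r, of "ac_class X t"] that by (auto simp: monomials_def)
  have "?summands s \<and> (s \<noteq> One \<longrightarrow> (\<forall>m\<in>monomial_terms X. ?product m s))"
    using assms(2,3)
  proof induction
    case one
    have "rd_times_graph X (ac_class X One) r r"
      using r rd_times_graph.one_left by (auto simp flip: sb_one_def)
    then show ?case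
      using single[of One] by (auto simp: atomic_polynomials_def sb_one_def)
  next
    case (monomial s)
    then show ?case
      using single[of s] mono by (meson monomial_atomic monomial_terms.mul)
  next
    case (sum s t)
    then obtain qs ps qs' ps' where qs: "qs \<noteq> []" "ac_class X s = sb_sum X qs"
        "set qs \<subseteq> atomic_polynomials X" "list_all2 (\<lambda>q p. rd_times_graph X q r p) qs ps"
      and qs': "qs' \<noteq> []" "ac_class X t = sb_sum X qs'"
        "set qs' \<subseteq> atomic_polynomials X" "list_all2 (\<lambda>q p. rd_times_graph X q r p) qs' ps'"
      by blast
    have eq: "ac_class X (Add s t) = sb_sum X (qs @ qs')"
      using qs qs' sum atomic_polynomials_poly sb_sum_append sb_add_ac_class
      by (metis (no_types, lifting) subset_trans)
    have all: "list_all2 (\<lambda>q p. rd_times_graph X q r p) (qs @ qs') (ps @ ps')"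
      using qs qs' by (intro list_all2_appendI)
    have Add: "ac_class X (Add s t) \<in> sum_polynomials X"
      using sum by (auto simp: sum_polynomials_def sum_poly_terms_def)
    have "length (qs @ qs') \<ge> 2"
      using qs(1) qs'(1) by (cases qs; cases qs') auto
    then have prod: "rd_times_graph X (ac_class X (Add s t)) r (sb_sum X (ps @ ps'))"
      using rd_times_graph.sum[OF Add r eq _ _ all] qs qs'
      by (auto simp: atomic_polynomials_def)
    \<comment> \<open>A sum behind the monomial \<open>m\<close> is the situation of the recursion clause for products.\<close>
    have "?product m (Add s t)" if m: "m \<in> monomial_terms X" for m
    proof -
      have "ac_class X m \<in> monomials X" using m by (simp add: monomials_def)
      moreover have "ac_class X (Mul m (Add s t)) = sb_times X (ac_class X m) (ac_class X (Add s t))"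
        using m sum by (subst sb_times_ac_class) (auto intro: poly_terms.monomial poly_terms.sum)
      ultimately show ?thesis
        using rd_times_graph.prod[OF _ Add _ r prod] by blast
    qed
    then show ?case using eq all qs qs'
      by (intro conjI impI ballI exI[of _ "qs @ qs'"] exI[of _ "ps @ ps'"]) auto
  next
    case (prod s t)
    have "Mul s t \<in> prod_poly_terms X" using prod by (auto simp: prod_poly_terms_def)
    then have "ac_class X (Mul s t) \<in> atomic_polynomials X"
      by (auto simp: atomic_polynomials_def prod_polynomials_def)
    moreover have "?product s t" using prod by blast
    ultimately have "?summands (Mul s t)" using single by blast
    \<comment> \<open>By associativity \<open>s\<close> joins the monomial \<open>m\<close>, and the induction hypothesis applies to \<open>t\<close>.\<close>
    moreover have "?product m (Mul s t)" if m: "m \<in> monomial_terms X" for m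
    proof -
      have ms: "Mul m s \<in> monomial_terms X" using m prod by (auto intro: monomial_terms.mul)
      have "Mul (Mul m s) t \<in> poly_terms X" "Mul m (Mul s t) \<in> poly_terms X"
        using m ms prod by (auto intro!: poly_terms.prod)
      then have "ac_class X (Mul m (Mul s t)) = ac_class X (Mul (Mul m s) t)"
        by (intro ac_class_eqI poly_simple equivclp_sym[OF Mul_assoc])
      then show ?thesis using prod ms by metis
    qed
    ultimately show ?case by blast
  qed simp
  then show "?summands s" and "s \<noteq> One \<Longrightarrow> m \<in> monomial_terms X \<Longrightarrow> ?product m s"
    by blast+
qed

lemma rd_times_graph_exists:
  assumes "q \<in> polynomials X" "r \<in> polynomials X"
  shows "\<exists>p. rd_times_graph X q r p"
proof (cases "q = sb_zero X \<or> r = sb_zero X \<or> r = sb_one X")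
  case True
  then show ?thesis using assms rd_times_graph.intros(1-3) by metis
next
  case False
  then obtain s where s: "s \<in> poly_terms X" "q = ac_class X s" "s \<noteq> Zero"
    using assms by (auto simp: polynomials_def sb_zero_def)
  have r: "r \<in> polynomials X - {sb_zero X, sb_one X}" using False assms by auto
  show ?thesis
    using s(1)
  proof cases
    case one
    then show ?thesis using s assms rd_times_graph.one_left by (metis sb_one_def)
  next
    case monomial
    then show ?thesis using s r rd_times_graph.monomial by (metis monomials_def imageI)
  next
    case (prod m t)
    then show ?thesis using rd_times_graph_total(2)[OF r] s by metis
  next
    case (sum u v)
    from rd_times_graph_total(1)[OF r s(1,3)] obtain qs ps
      where qs: "qs \<noteq> []" "q = sb_sum X qs" "set qs \<subseteq> atomic_polynomials X"
        "list_all2 (\<lambda>q p. rd_times_graph X q r p) qs ps"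
      using s by auto
    show ?thesis
    \<comment> \<open>A single summand would be \<open>q\<close> itself, and its product with \<open>r\<close> is then in the list \<open>ps\<close>.\<close>
    proof (cases "length qs \<ge> 2")
      case True
      have "q \<in> sum_polynomials X"
        using s sum by (auto simp: sum_polynomials_def sum_poly_terms_def)
      then show ?thesis
        using rd_times_graph.sum[OF _ r qs(2) True _ qs(4)] qs(3)
        by (auto simp: atomic_polynomials_def)
    next
      case False
      then obtain q' where "qs = [q']" using qs(1) by (cases qs) (auto simp: Suc_le_eq)
      then show ?thesis
        using qs atomic_polynomials_poly[of X]
        by (auto simp: list_all2_Cons1 sb_sum_single[OF subsetD])
    qed
  qed (use s in auto)
qed

lemma
  assumes "q \<in> polynomials X" "r \<in> polynomials X"
  shows rd_times_poly: "rd_times X q r \<in> polynomials X"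
    and class_nf_rd_times: "class_nf (rd_times X q r) = nf_times (class_nf q) (class_nf r)"
proof -
  have "rd_times_graph X q r (rd_times X q r)"
    unfolding rd_times_def
    using rd_times_graph_exists[OF assms] rd_times_graph_unique by (metis (full_types) theI)
  then show "rd_times X q r \<in> polynomials X"
    "class_nf (rd_times X q r) = nf_times (class_nf q) (class_nf r)"
    by (auto dest: rd_times_graph_sound)
qed

text \<open>Neutrality of \<open>1\<close> on the right is inherited from terms, as it fails for some multisets.\<close>

lemma class_nf_unit_right:
  "p \<in> polynomials X \<Longrightarrow> nf_times (class_nf p) {#Unit#} = class_nf p"
  by (auto simp: polynomials_def)

theorem theorem4p14:
  fixes X :: "'x set"
  assumes "X \<noteq> {}"
  shows "right_distributive_strong_bimonoid (N_rd X)"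
proof -
  have eq_iff_nf: "p = q \<longleftrightarrow> class_nf p = class_nf q"
    if "p \<in> polynomials X" "q \<in> polynomials X" for p q
    using that class_nf_inj by metis
  note poly = sb_add_poly rd_times_poly
    and nf = class_nf_add class_nf_rd_times class_nf_unit_right
  have "abelian_monoid (N_rd X)"
    by (rule abelian_monoidI) (simp_all add: N_rd_def poly nf eq_iff_nf ac_simps)
  moreover have "Group.monoid (N_rd X)"
    by (rule monoidI) (simp_all add: N_rd_def poly nf eq_iff_nf nf_times_assoc)
  ultimately show ?thesis
    unfolding right_distributive_strong_bimonoid_def strong_bimonoid_def
      strong_bimonoid_axioms_def right_distributive_strong_bimonoid_axioms_def
    by (simp add: N_rd_def poly nf eq_iff_nf)
qed

end
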